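(* For every integer $n\geq2$, the Radon transform is not injective on the dicyclic group $Dic_n$.
   Context: The dicyclic group $Dic_n$ is the group of order $4n$ generated by two elements $a$ and $b$ subject to the relations $a^{2n}=e$, $b^2=a^n$ and $ab=ba^{-1}$. For a finite group $G$ and $m\ge 2$ let $C_m$ be the cyclic group of order $m$, and let $\Gamma_m$ be the set of nontrivial homomorphisms $C_m\to G$. For $f:G\to\mathbb{C}$, $x\in G$ and $\gamma\in\Gamma_m$ put $R_mf(x,\gamma)=\sum_{t\in C_m}f(x\gamma(t))$. The Radon transform on $G$ is $Rf=(R_mf)_{m\ge2}$; it is injective on $G$ if the only $f:G\to\mathbb{C}$ with $R_mf=0$ for all $m\ge2$ is $f=0$. *)

theory Defs
  imports Complex_Main "HOL-Algebra.Algebra"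
begin

(* The order condition excludes the proper quotients of the dicyclic group, so that
   the predicate determines G up to isomorphism. *)
definition dicyclic_group :: "nat \<Rightarrow> ('a, 'b) monoid_scheme \<Rightarrow> bool" where
  "dicyclic_group n G \<longleftrightarrow>
     group G \<and> order G = 4 * n \<and>
     (\<exists>a\<in>carrier G. \<exists>b\<in>carrier G.
        generate G {a, b} = carrier G \<and>
        a [^]\<^bsub>G\<^esub> (2 * n) = \<one>\<^bsub>G\<^esub> \<and>
        b [^]\<^bsub>G\<^esub> (2::nat) = a [^]\<^bsub>G\<^esub> n \<and>
        a \<otimes>\<^bsub>G\<^esub> b = b \<otimes>\<^bsub>G\<^esub> inv\<^bsub>G\<^esub> a)"

(* integer_mod_group m has carrier {0..<m} for m > 0.  Values of a homomorphism
   outside that carrier are unconstrained; nothing below depends on them. *)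
definition nontrivial_homs :: "nat \<Rightarrow> ('a, 'b) monoid_scheme \<Rightarrow> (int \<Rightarrow> 'a) set" where
  "nontrivial_homs m G =
     {\<gamma> \<in> hom (integer_mod_group m) G.
        \<exists>t\<in>carrier (integer_mod_group m). \<gamma> t \<noteq> \<one>\<^bsub>G\<^esub>}"

definition radon ::
    "('a, 'b) monoid_scheme \<Rightarrow> nat \<Rightarrow> ('a \<Rightarrow> complex) \<Rightarrow> 'a \<Rightarrow> (int \<Rightarrow> 'a) \<Rightarrow> complex" where
  "radon G m f x \<gamma> = (\<Sum>t\<in>carrier (integer_mod_group m). f (x \<otimes>\<^bsub>G\<^esub> \<gamma> t))"

definition radon_injective :: "('a, 'b) monoid_scheme \<Rightarrow> bool" where
  "radon_injective G \<longleftrightarrow>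
     (\<forall>f :: 'a \<Rightarrow> complex.
        (\<forall>m\<ge>2. \<forall>x\<in>carrier G. \<forall>\<gamma>\<in>nontrivial_homs m G. radon G m f x \<gamma> = 0) \<longrightarrow>
        (\<forall>x\<in>carrier G. f x = 0))"

(* A concrete model, showing that dicyclic_group n is satisfiable for every n \<ge> 1:
   the pair (i, s) stands for a ^ i * b ^ s. *)
definition dicyclic_model :: "nat \<Rightarrow> (int \<times> bool) monoid" where
  "dicyclic_model n =
     \<lparr>carrier = {0..<2 * int n} \<times> UNIV,
      monoid.mult = (\<lambda>(i, s) (k, t).
        ((i + (if s then - k else k) + (if s \<and> t then int n else 0)) mod (2 * int n), s \<noteq> t)),
      one = (0, False)\<rparr>"

lemma group_dicyclic_model:
  assumes "n \<ge> 1"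
  shows "group (dicyclic_model n)"
proof (rule groupI)
  fix x y assume "x \<in> carrier (dicyclic_model n)" "y \<in> carrier (dicyclic_model n)"
  then show "x \<otimes>\<^bsub>dicyclic_model n\<^esub> y \<in> carrier (dicyclic_model n)"
    using assms by (auto simp: dicyclic_model_def)
next
  show "\<one>\<^bsub>dicyclic_model n\<^esub> \<in> carrier (dicyclic_model n)"
    using assms by (auto simp: dicyclic_model_def)
next
  fix x y z :: "int \<times> bool"
  obtain i s where x: "x = (i, s)" by fastforce
  obtain j t where y: "y = (j, t)" by fastforce
  obtain k u where z: "z = (k, u)" by fastforce
  have shift: "(p - int n) mod (2 * int n) = (p + int n) mod (2 * int n)" for p
    using mod_add_self2[of "p - int n" "2 * int n"] by (simp add: algebra_simps)
  have reduce: "(int n + p mod (int n * 2) - q) mod (int n * 2) = (int n + p - q) mod (int n * 2)"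
    for p q
    using mod_add_left_eq[of p "int n * 2" "int n - q"] by (simp add: algebra_simps)
  show "x \<otimes>\<^bsub>dicyclic_model n\<^esub> y \<otimes>\<^bsub>dicyclic_model n\<^esub> z =
        x \<otimes>\<^bsub>dicyclic_model n\<^esub> (y \<otimes>\<^bsub>dicyclic_model n\<^esub> z)"
    unfolding x y z dicyclic_model_def
    using shift[of "i - j + k"] shift[of "i - j - k"]
    by (cases s; cases t; cases u) (auto simp: mod_simps algebra_simps reduce)
next
  fix x assume "x \<in> carrier (dicyclic_model n)"
  then show "\<one>\<^bsub>dicyclic_model n\<^esub> \<otimes>\<^bsub>dicyclic_model n\<^esub> x = x"
    by (auto simp: dicyclic_model_def)
next
  fix x assume x: "x \<in> carrier (dicyclic_model n)"
  obtain i s where xs: "x = (i, s)" by fastforce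
  let ?y = "((if s then i + int n else - i) mod (2 * int n), s)"
  have "?y \<in> carrier (dicyclic_model n)"
    using assms by (auto simp: dicyclic_model_def)
  moreover have "?y \<otimes>\<^bsub>dicyclic_model n\<^esub> x = \<one>\<^bsub>dicyclic_model n\<^esub>"
    using mod_add_left_eq[of "i + int n" "2 * int n" "int n - i"]
    by (auto simp: xs dicyclic_model_def mod_simps algebra_simps)
  ultimately show "\<exists>y\<in>carrier (dicyclic_model n). y \<otimes>\<^bsub>dicyclic_model n\<^esub> x = \<one>\<^bsub>dicyclic_model n\<^esub>"
    by blast
qed

lemma dicyclic_group_dicyclic_model:
  assumes "n \<ge> 1"
  shows "dicyclic_group n (dicyclic_model n)"
proof -
  let ?G = "dicyclic_model n" and ?N = "2 * int n"
  interpret group ?G by (rule group_dicyclic_model[OF assms])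
  define a where "a = (1::int, False)"
  define b where "b = (0::int, True)"
  have N: "?N \<ge> 2" using assms by simp
  have a: "a \<in> carrier ?G" and b: "b \<in> carrier ?G"
    using N by (auto simp: dicyclic_model_def a_def b_def)
  have pow: "a [^]\<^bsub>?G\<^esub> k = (int k mod ?N, False)" for k :: nat
  proof (induction k)
    case 0 then show ?case by (simp add: dicyclic_model_def)
  next
    case (Suc k)
    then have "a [^]\<^bsub>?G\<^esub> Suc k = (int k mod ?N, False) \<otimes>\<^bsub>?G\<^esub> (1, False)"
      by (simp add: a_def)
    then show ?case by (simp add: dicyclic_model_def mod_simps add.commute)
  qed
  have inva: "inv\<^bsub>?G\<^esub> a = ((- 1) mod ?N, False)"
    using a N by (intro inv_equality) (auto simp: dicyclic_model_def a_def mod_simps)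
  have gen: "generate ?G {a, b} = carrier ?G"
  proof
    show "generate ?G {a, b} \<subseteq> carrier ?G"
      using a b by (intro generate_incl) auto
    have "a [^]\<^bsub>?G\<^esub> k \<in> generate ?G {a, b}" for k :: nat
      by (induction k) (auto intro: generate.intros)
    then have 1: "(i, False) \<in> generate ?G {a, b}" if "0 \<le> i" "i < ?N" for i
      using that pow[of "nat i"] by (metis int_nat_eq mod_pos_pos_trivial)
    have 2: "(i, True) \<in> generate ?G {a, b}" if "0 \<le> i" "i < ?N" for i
    proof -
      have "(i, False) \<otimes>\<^bsub>?G\<^esub> b \<in> generate ?G {a, b}"
        by (rule generate.eng[OF 1[OF that] generate.incl]) simp
      then show ?thesis using that by (simp add: dicyclic_model_def b_def)
    qed
    show "carrier ?G \<subseteq> generate ?G {a, b}"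
    proof
      fix x assume x: "x \<in> carrier ?G"
      obtain i s where "x = (i, s)" by fastforce
      with x 1 2 show "x \<in> generate ?G {a, b}"
        by (cases s) (auto simp: dicyclic_model_def)
    qed
  qed
  have ord: "order ?G = 4 * n"
    by (simp add: order_def dicyclic_model_def card_cartesian_product)
  have bb: "b [^]\<^bsub>?G\<^esub> (2::nat) = a [^]\<^bsub>?G\<^esub> n"
    unfolding pow using b by (simp add: numeral_2_eq_2) (simp add: dicyclic_model_def b_def)
  have ab: "a \<otimes>\<^bsub>?G\<^esub> b = b \<otimes>\<^bsub>?G\<^esub> inv\<^bsub>?G\<^esub> a"
    unfolding inva using N by (simp add: dicyclic_model_def a_def b_def mod_simps)
  have aN: "a [^]\<^bsub>?G\<^esub> (2 * n) = \<one>\<^bsub>?G\<^esub>"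
    unfolding pow by (simp add: dicyclic_model_def)
  show ?thesis
    unfolding dicyclic_group_def
    using is_group ord a b gen aN bb ab by blast
qed

end

theory Submission
  imports Defs
begin

text \<open>
  Let \<open>A\<close> be the cyclic subgroup generated by \<open>a\<close>.  It has order \<open>2n\<close>, and every element
  outside \<open>A\<close> has the form \<open>a\<^sup>i b\<close>, whose square is \<open>a\<^sup>n \<noteq> 1\<close>.  So every nontrivial cyclic
  subgroup of the dicyclic group meets \<open>A\<close> nontrivially
  (\<open>ex_nontrivial_pow_in_cyclic_subgroup\<close>).

  This alone destroys injectivity (\<open>not_radon_injective_if_cyclic_meets\<close>).  Take a faithful
  character of \<open>A\<close> and extend it by zero to \<open>f : G \<rightarrow> \<complex>\<close>.  Then \<open>f (x c) = \<chi>(c) f(x)\<close> for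
  all \<open>x \<in> G\<close>, \<open>c \<in> A\<close>.  For a nontrivial homomorphism \<open>\<gamma>\<close> choose \<open>s\<close> such that \<open>\<gamma>(s)\<close> is a
  nontrivial element of \<open>A\<close>.  Substituting \<open>t + s\<close> for \<open>t\<close> in the sum that defines the Radon
  transform multiplies it by \<open>\<chi>(\<gamma>(s)) \<noteq> 1\<close>, so the sum is zero, whereas \<open>f(1) = 1\<close>.
\<close>

section \<open>Functions that transform by a character of a cyclic subgroup\<close>

lemma cis_root_of_unity_powi_eq_1_iff:
  fixes N :: nat and k :: int
  assumes "N > 0"
  shows "cis (2 * pi / N) powi k = 1 \<longleftrightarrow> int N dvd k"
proof
  assume "cis (2 * pi / N) powi k = 1"
  then have "cos (k * (2 * pi / N)) = 1"
    unfolding cis_power_int by (metis cis.sel(1) one_complex.sel(1))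
  then obtain l :: int where "k * (2 * pi / N) = real_of_int l * 2 * pi"
    unfolding cos_one_2pi_int by blast
  then have "real_of_int k = real_of_int (l * int N)"
    using assms by (simp add: field_simps)
  then have "k = l * int N"
    by (simp only: of_int_eq_iff)
  then show "int N dvd k"
    by simp
next
  assume "int N dvd k"
  then obtain l where "k = int N * l" ..
  then have "cis (2 * pi / N) powi k = cis (2 * pi * l)"
    unfolding cis_power_int using assms by (simp add: field_simps)
  then show "cis (2 * pi / N) powi k = 1"
    by simp
qed

context group
begin

text \<open>The function is a faithful character of the cyclic subgroup, extended by zero.\<close>

lemma ex_function_transforming_by_faithful_character:
  assumes a: "a \<in> carrier G" and fin: "ord a > 0"
  obtains f :: "'a \<Rightarrow> complex" and \<omega> :: complex
  where "f \<one> = 1"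
    and "\<And>x k. x \<in> carrier G \<Longrightarrow> f (x \<otimes> a [^] (k::int)) = \<omega> powi k * f x"
    and "\<And>k. \<omega> powi k = 1 \<longleftrightarrow> a [^] k = \<one>"
proof -
  define \<omega> where "\<omega> = cis (2 * pi / ord a)"
  have \<omega>0: "\<omega> \<noteq> 0"
    by (simp add: \<omega>_def)
  have faithful: "\<omega> powi k = 1 \<longleftrightarrow> a [^] k = \<one>" for k
    unfolding \<omega>_def cis_root_of_unity_powi_eq_1_iff[OF fin] int_pow_eq_id[OF a] ..
  \<comment> \<open>The exponent of an element of the subgroup is unique modulo \<open>ord a\<close> only, which is all
      that a power of \<open>\<omega>\<close> depends on; so the choice in the definition of \<open>f\<close> is harmless.\<close>
  have eq: "\<omega> powi k = \<omega> powi l" if "a [^] k = a [^] l" for k l :: int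
  proof -
    have "a [^] (l - k) = \<one>"
      using that a by (simp add: int_pow_eq int_pow_eq_id)
    then have "\<omega> powi (l - k) = 1"
      using faithful by blast
    then show ?thesis
      using \<omega>0 by (simp add: power_int_diff)
  qed
  define f where
    "f x = (if \<exists>k::int. x = a [^] k then \<omega> powi (SOME k. x = a [^] k) else 0)" for x
  have f_pow: "f (a [^] k) = \<omega> powi k" for k :: int
  proof -
    have "a [^] k = a [^] (SOME l::int. a [^] k = a [^] l)"
      by (rule someI) (rule refl)
    from eq[OF this] show ?thesis
      by (auto simp: f_def)
  qed
  have "f (x \<otimes> a [^] k) = \<omega> powi k * f x" if x: "x \<in> carrier G" for x and k :: int
  proof (cases "\<exists>l::int. x = a [^] l")
    case True
    then obtain l :: int where "x = a [^] l" ..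
    then show ?thesis
      using a \<omega>0 by (simp add: f_pow power_int_add flip: int_pow_mult)
  next
    case False
    \<comment> \<open>Multiplication by \<open>a\<^sup>k\<close> preserves the complement of the subgroup, so both sides vanish.\<close>
    have "x = a [^] (l - k)" if "x \<otimes> a [^] k = a [^] l" for l :: int
      using that a x by (metis int_pow_closed int_pow_diff inv_solve_right)
    with False have "\<nexists>l::int. x \<otimes> a [^] k = a [^] l"
      by blast
    with False show ?thesis
      by (simp add: f_def)
  qed
  moreover have "f \<one> = 1"
    using f_pow[of 0] by simp
  ultimately show ?thesis
    using that faithful by blast
qed

text \<open>The proof shifts the summation variable: the sum is then a multiple of itself by
  a factor other than \<open>1\<close>.\<close>

lemma radon_eq_0_if_transforms:
  assumes m: "m > 0" and \<gamma>: "\<gamma> \<in> hom (integer_mod_group m) G" and x: "x \<in> carrier G"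
    and s: "s \<in> carrier (integer_mod_group m)"
    and f: "\<And>y. y \<in> carrier G \<Longrightarrow> f (y \<otimes> \<gamma> s) = w * f y" and w: "w \<noteq> 1"
  shows "radon G m f x \<gamma> = 0"
proof -
  let ?C = "integer_mod_group m"
  interpret C: group ?C by simp
  have \<gamma>_closed: "\<gamma> t \<in> carrier G" if "t \<in> carrier ?C" for t
    using \<gamma> that by (auto simp: hom_def)
  have "radon G m f x \<gamma> = (\<Sum>t\<in>carrier ?C. f (x \<otimes> \<gamma> (t \<otimes>\<^bsub>?C\<^esub> s)))"
    unfolding radon_def
    by (rule sum.reindex_bij_witness
          [of _ "\<lambda>t. t \<otimes>\<^bsub>?C\<^esub> s" "\<lambda>t. t \<otimes>\<^bsub>?C\<^esub> inv\<^bsub>?C\<^esub> s"])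
      (use s in \<open>simp_all add: C.m_assoc del: mult_integer_mod_group inv_integer_mod_group
                                            one_integer_mod_group\<close>)
  also have "\<dots> = (\<Sum>t\<in>carrier ?C. w * f (x \<otimes> \<gamma> t))"
  proof (rule sum.cong[OF refl])
    fix t assume t: "t \<in> carrier ?C"
    show "f (x \<otimes> \<gamma> (t \<otimes>\<^bsub>?C\<^esub> s)) = w * f (x \<otimes> \<gamma> t)"
      unfolding hom_mult[OF \<gamma> t s] using f[of "x \<otimes> \<gamma> t"] x s t \<gamma>_closed
      by (simp add: m_assoc)
  qed
  also have "\<dots> = w * radon G m f x \<gamma>"
    by (simp add: radon_def sum_distrib_left)
  finally show ?thesis
    using w by simp
qed

text \<open>Some value of a nontrivial homomorphism is nontrivial, and by hypothesis it has a power
  that is a nontrivial power of \<open>a\<close>; this power is again a value of the homomorphism, and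
  shifting by its argument kills the transform of the function constructed above.\<close>

theorem not_radon_injective_if_cyclic_meets:
  assumes a: "a \<in> carrier G" and fin: "ord a > 0"
    and meets: "\<And>g. g \<in> carrier G \<Longrightarrow> g \<noteq> \<one> \<Longrightarrow>
      \<exists>(j::nat) (k::int). g [^] j = a [^] k \<and> a [^] k \<noteq> \<one>"
  shows "\<not> radon_injective G"
proof
  assume inj: "radon_injective G"
  obtain f :: "'a \<Rightarrow> complex" and \<omega> :: complex where f1: "f \<one> = 1"
    and f: "\<And>x k. x \<in> carrier G \<Longrightarrow> f (x \<otimes> a [^] (k::int)) = \<omega> powi k * f x"
    and faithful: "\<And>k. \<omega> powi k = 1 \<longleftrightarrow> a [^] k = \<one>"
    using ex_function_transforming_by_faithful_character[OF a fin] by blast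
  have "radon G m f x \<gamma> = 0"
    if m: "m \<ge> 2" and x: "x \<in> carrier G" and \<gamma>: "\<gamma> \<in> nontrivial_homs m G" for m x \<gamma>
  proof -
    let ?C = "integer_mod_group m"
    interpret C: group ?C by simp
    from \<gamma> obtain t where hom: "\<gamma> \<in> hom ?C G" and t: "t \<in> carrier ?C" and "\<gamma> t \<noteq> \<one>"
      unfolding nontrivial_homs_def by blast
    moreover from hom t have "\<gamma> t \<in> carrier G"
      by (auto simp: hom_def)
    ultimately obtain j :: nat and k :: int where jk: "\<gamma> t [^] j = a [^] k" "a [^] k \<noteq> \<one>"
      using meets by blast
    define s where "s = t [^]\<^bsub>?C\<^esub> j"
    have s: "s \<in> carrier ?C"
      unfolding s_def using t by (rule C.nat_pow_closed)
    have \<gamma>s: "\<gamma> s = a [^] k"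
      unfolding s_def using hom_nat_pow[OF hom t C.is_group is_group] jk(1) by (rule trans)
    show ?thesis
    proof (rule radon_eq_0_if_transforms[OF _ hom x s])
      show "f (y \<otimes> \<gamma> s) = \<omega> powi k * f y" if "y \<in> carrier G" for y
        unfolding \<gamma>s using that by (rule f)
      show "\<omega> powi k \<noteq> 1"
        using faithful jk(2) by blast
    qed (use m in simp)
  qed
  then have "f \<one> = 0"
    using inj unfolding radon_injective_def by blast
  with f1 show False
    by simp
qed

end

section \<open>Cyclic subgroups of the dicyclic group\<close>

context group
begin

lemma pow_mult_eq_if_conj_inv:
  assumes a: "a \<in> carrier G" and b: "b \<in> carrier G" and ab: "a \<otimes> b = b \<otimes> inv a"
  shows "b \<otimes> a [^] (k::int) = a [^] (- k) \<otimes> b"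
proof -
  have "a = b \<otimes> inv a \<otimes> inv b"
    using ab a b by (metis inv_closed inv_solve_right m_closed)
  then have "inv a = b \<otimes> a \<otimes> inv b"
    using a b by (metis inv_closed inv_inv inv_mult_group m_assoc m_closed)
  then have ba: "b \<otimes> a = inv a \<otimes> b"
    using a b by (metis inv_closed inv_solve_right m_closed)
  have nat: "b \<otimes> c [^] (j::nat) = inv c [^] j \<otimes> b"
    if c: "c \<in> carrier G" and bc: "b \<otimes> c = inv c \<otimes> b" for c j
  proof (induction j)
    case 0
    show ?case using b by simp
  next
    case (Suc j)
    have "b \<otimes> c [^] Suc j = inv c [^] j \<otimes> (b \<otimes> c)"
      using Suc b c by (simp flip: m_assoc)
    also have "\<dots> = inv c [^] Suc j \<otimes> b"
      using b c by (simp add: bc m_assoc)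
    finally show ?case .
  qed
  show ?thesis
  proof (cases k rule: int_cases2)
    case (nonneg j)
    then show ?thesis
      using nat[OF a ba, of j] a by (simp add: int_pow_neg int_pow_int nat_pow_inv)
  next
    case (nonpos j)
    \<comment> \<open>For \<open>c = a\<^sup>-\<^sup>1\<close> the hypothesis of \<open>nat\<close> is the given relation itself.\<close>
    then show ?thesis
      using nat[of "inv a" j] a ab by (simp add: int_pow_neg int_pow_int nat_pow_inv)
  qed
qed

text \<open>The normal form \<open>a\<^sup>i\<close> or \<open>a\<^sup>i b\<close>: such elements are closed under multiplication
  because \<open>b\<close> can be moved to the right of powers of \<open>a\<close> and \<open>b\<^sup>2\<close> is itself a power
  of \<open>a\<close>.\<close>

lemma dicyclic_normal_form:
  assumes a: "a \<in> carrier G" and b: "b \<in> carrier G" and ab: "a \<otimes> b = b \<otimes> inv a"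
    and bb: "b \<otimes> b = a [^] (n::int)" and x: "x \<in> generate G {a, b}"
  shows "\<exists>k::int. x = a [^] k \<or> x = a [^] k \<otimes> b"
  using x
proof induction
  case one
  show ?case by (metis int_pow_0)
next
  case (incl h)
  then consider "h = a" | "h = b" by blast
  then show ?case
  proof cases
    case 1
    then show ?thesis using a by (metis int_pow_1)
  next
    case 2
    then show ?thesis using b by (metis int_pow_0 l_one)
  qed
next
  case (inv h)
  then consider "h = a" | "h = b" by blast
  then show ?case
  proof cases
    case 1
    then show ?thesis using a by (metis int_pow_1 int_pow_neg)
  next
    case 2
    have "a [^] (- n) \<otimes> b \<otimes> b = \<one>"
      using a b by (simp add: m_assoc bb flip: int_pow_mult)
    then have "inv b = a [^] (- n) \<otimes> b"
      using a b by (intro inv_equality) auto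
    with 2 show ?thesis by blast
  qed
next
  case (eng g h)
  note move = pow_mult_eq_if_conj_inv[OF a b ab]
  obtain i j :: int where g: "g = a [^] i \<or> g = a [^] i \<otimes> b"
    and h: "h = a [^] j \<or> h = a [^] j \<otimes> b"
    using eng.IH by blast
  have 1: "a [^] i \<otimes> (a [^] j \<otimes> c) = a [^] (i + j) \<otimes> c" if "c \<in> carrier G" for c and i j :: int
    using a that by (simp add: int_pow_mult m_assoc)
  have 2: "a [^] i \<otimes> b \<otimes> a [^] j = a [^] (i - j) \<otimes> b"
    using a b 1[of b i "- j"] by (simp add: m_assoc move)
  have 3: "a [^] i \<otimes> b \<otimes> (a [^] j \<otimes> b) = a [^] (i - j + n)"
  proof -
    have "a [^] i \<otimes> b \<otimes> (a [^] j \<otimes> b) = a [^] (i - j) \<otimes> b \<otimes> b"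
      using a b 2 by (simp flip: m_assoc)
    then show ?thesis
      using a b by (simp add: m_assoc bb int_pow_mult)
  qed
  have 4: "a [^] i \<otimes> a [^] j = a [^] (i + j)"
    using a by (simp add: int_pow_mult)
  show ?case
    using g h 1[OF b, of i j] 2 3 4 by metis
qed

text \<open>By the normal form, \<open>G\<close> is covered by two cosets of the subgroup generated by \<open>a\<close>,
  so that subgroup has at least \<open>2n\<close> elements.\<close>

lemma ord_of_dicyclic_relations:
  assumes a: "a \<in> carrier G" and b: "b \<in> carrier G"
    and normal: "\<And>x. x \<in> carrier G \<Longrightarrow> \<exists>k::int. x = a [^] k \<or> x = a [^] k \<otimes> b"
    and a2n: "a [^] (2 * n) = \<one>" and order: "order G = 4 * n" and n: "n > 0"
  shows "ord a = 2 * n"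
proof -
  let ?A = "generate G {a}"
  have fin: "finite (carrier G)"
    using order n by (simp add: order_gt_0_iff_finite[symmetric])
  have A: "?A = {a [^] (k::int) | k. k \<in> UNIV}"
    using generate_pow[OF a] .
  have finA: "finite ?A"
    using generate_incl[of "{a}"] a fin by (auto intro: finite_subset)
  have "carrier G \<subseteq> ?A \<union> (\<lambda>x. x \<otimes> b) ` ?A"
    using normal unfolding A by blast
  then have "card (carrier G) \<le> card (?A \<union> (\<lambda>x. x \<otimes> b) ` ?A)"
    using finA by (intro card_mono) auto
  also have "\<dots> \<le> card ?A + card ((\<lambda>x. x \<otimes> b) ` ?A)"
    by (rule card_Un_le)
  also have "\<dots> \<le> card ?A + card ?A"
    using card_image_le[OF finA] by simp
  finally have "2 * n \<le> ord a"
    using order generate_pow_card[OF a] by (simp add: order_def)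
  moreover have "ord a \<le> 2 * n"
    using pow_eq_id[OF a, of "2 * n"] a2n n by (auto intro: dvd_imp_le)
  ultimately show ?thesis
    by simp
qed

text \<open>An element \<open>a\<^sup>k\<close> is itself the required power.  For \<open>a\<^sup>k b\<close> the square works: it is
  \<open>a\<^sup>k a\<^sup>-\<^sup>k b\<^sup>2 = a\<^sup>n\<close>, whatever \<open>k\<close> is.\<close>

lemma ex_nontrivial_pow_in_cyclic_subgroup:
  assumes a: "a \<in> carrier G" and b: "b \<in> carrier G" and ab: "a \<otimes> b = b \<otimes> inv a"
    and bb: "b \<otimes> b = a [^] (n::int)" and an: "a [^] n \<noteq> \<one>"
    and g: "g \<in> generate G {a, b}" and g1: "g \<noteq> \<one>"
  shows "\<exists>(j::nat) (k::int). g [^] j = a [^] k \<and> a [^] k \<noteq> \<one>"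
proof -
  obtain k :: int where "g = a [^] k \<or> g = a [^] k \<otimes> b"
    using dicyclic_normal_form[OF a b ab bb g] by blast
  then show ?thesis
  proof
    assume k: "g = a [^] k"
    then have "g [^] (1::nat) = a [^] k"
      using a by simp
    with k g1 show ?thesis by blast
  next
    assume k: "g = a [^] k \<otimes> b"
    have "g [^] (2::nat) = a [^] k \<otimes> (b \<otimes> a [^] k) \<otimes> b"
      using a b by (simp add: k numeral_2_eq_2 m_assoc)
    also have "\<dots> = a [^] k \<otimes> a [^] (- k) \<otimes> (b \<otimes> b)"
      using a b by (simp add: pow_mult_eq_if_conj_inv[OF a b ab] m_assoc)
    also have "\<dots> = a [^] n"
      using a by (simp add: bb flip: int_pow_mult)
    finally show ?thesis
      using an by blast
  qed
qed

end

theorem proposition5p4: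
  fixes n :: nat and G :: "('a, 'b) monoid_scheme"
  assumes "n \<ge> 2" and "dicyclic_group n G"
  shows "\<not> radon_injective G"
proof -
  interpret group G
    using assms(2) by (simp add: dicyclic_group_def)
  obtain a b where order: "order G = 4 * n"
    and a: "a \<in> carrier G" and b: "b \<in> carrier G"
    and gen: "generate G {a, b} = carrier G"
    and a2n: "a [^]\<^bsub>G\<^esub> (2 * n) = \<one>\<^bsub>G\<^esub>"
    and b2: "b [^]\<^bsub>G\<^esub> (2::nat) = a [^]\<^bsub>G\<^esub> n"
    and ab: "a \<otimes>\<^bsub>G\<^esub> b = b \<otimes>\<^bsub>G\<^esub> inv\<^bsub>G\<^esub> a"
    using assms(2) unfolding dicyclic_group_def by blast
  have bb: "b \<otimes>\<^bsub>G\<^esub> b = a [^]\<^bsub>G\<^esub> int n"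
    using b2 b by (simp add: numeral_2_eq_2 int_pow_int)
  have normal: "\<exists>k::int. x = a [^]\<^bsub>G\<^esub> k \<or> x = a [^]\<^bsub>G\<^esub> k \<otimes>\<^bsub>G\<^esub> b" if "x \<in> carrier G" for x
    using dicyclic_normal_form[OF a b ab bb, of x] that by (simp add: gen)
  have ord: "ord a = 2 * n"
    using ord_of_dicyclic_relations[OF a b normal a2n order] assms(1) by simp
  have an: "a [^]\<^bsub>G\<^esub> int n \<noteq> \<one>\<^bsub>G\<^esub>"
    using int_pow_eq_id[OF a, of "int n"] ord assms(1) by (auto dest: zdvd_imp_le)
  show ?thesis
  proof (rule not_radon_injective_if_cyclic_meets[OF a])
    show "ord a > 0"
      using ord assms(1) by simp
  next
    fix g assume "g \<in> carrier G" "g \<noteq> \<one>\<^bsub>G\<^esub>"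
    then show "\<exists>(j::nat) (k::int). g [^]\<^bsub>G\<^esub> j = a [^]\<^bsub>G\<^esub> k \<and> a [^]\<^bsub>G\<^esub> k \<noteq> \<one>\<^bsub>G\<^esub>"
      using ex_nontrivial_pow_in_cyclic_subgroup[OF a b ab bb an] by (simp add: gen)
  qed
qed

end
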